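(* For all real numbers $a>0$ and $\lambda\ge 0$, $$\int_{0}^{\infty} \frac{a}{(2\pi)^{1/2}\, t^{3/2}}\, e^{-a^2/(2t)}\, e^{-\lambda t}\, dt = e^{-a(2\lambda)^{1/2}} .$$ Taking $a=1$ and $\theta=(2\lambda)^{1/2}$, this can be written as follows: for every real $\theta\ge 0$, if $G\sim\mathcal{G}(1/2,1/2)$, then $$E\left[\exp\{-\theta^2/(2G)\}\right]=\exp(-\theta).$$
   Context: $\mathcal{G}(1/2,1/2)$ denotes the gamma distribution with shape $1/2$ and rate $1/2$, i.e. the distribution on $(0,\infty)$ with density $x\mapsto (2\pi)^{-1/2}x^{-1/2}e^{-x/2}$. $E$ denotes expectation. *)

theory Defs
  imports "HOL-Probability.Probability"
begin

text \<open>
  The gamma distribution with real shape \<open>\<alpha>\<close> and rate (not scale) \<open>\<beta>\<close>, given by its density with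
  respect to Lebesgue measure. The library's \<open>erlang_density\<close> only covers integer shapes.
\<close>

definition gamma_density :: "real \<Rightarrow> real \<Rightarrow> real \<Rightarrow> real" where
  "gamma_density \<alpha> \<beta> x =
    (if x > 0 then \<beta> powr \<alpha> / Gamma \<alpha> * x powr (\<alpha> - 1) * exp (- \<beta> * x) else 0)"

lemma gamma_density_half_half:
  "gamma_density (1/2) (1/2) x =
    (if x > 0 then (2 * pi) powr (-1/2) * x powr (-1/2) * exp (- x / 2) else 0)"
  by (simp add: gamma_density_def Gamma_one_half_real powr_minus powr_half_sqrt
      real_sqrt_mult real_sqrt_divide field_simps)

end

theory Submission
  imports Defs "HOL-Real_Asymp.Real_Asymp"
begin

text \<open>
  Both integrands have elementary primitives in terms of the standard normal distribution
  function \<open>\<Phi>\<close>. With \<open>F\<^sub>c t = exp (- a * c) * \<Phi> (c * sqrt t - a / sqrt t)\<close>, where \<open>a > 0\<close>, the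
  derivatives of \<open>F\<^sub>c\<close> and \<open>F\<^bsub>-c\<^esub>\<close> share the Gaussian factor \<open>exp (- a\<^sup>2 / (2 * t) - c\<^sup>2 * t / 2)\<close>,
  because the cross term of the completed square cancels against \<open>exp (- a * c)\<close>. Hence
  \<open>F\<^sub>c + F\<^bsub>-c\<^esub>\<close> is a primitive of the first integrand when \<open>c\<^sup>2 = 2 * lam\<close>, and \<open>F\<^sub>1 - F\<^bsub>-1\<^esub>\<close>, with
  \<open>a = \<theta>\<close>, of the integrand that defines the expectation.
\<close>

section \<open>The standard normal distribution function: derivative, limits and reflection\<close>

abbreviation std_normal_cdf :: "real \<Rightarrow> real" where
  "std_normal_cdf \<equiv> cdf std_normal_distribution"

lemma measure_std_normal_eq_integral:
  assumes [measurable]: "A \<in> sets borel"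
  shows "measure std_normal_distribution A = (LBINT x:A. std_normal_density x)"
proof -
  interpret real_distribution std_normal_distribution by (rule real_dist_normal_dist)
  have "measure std_normal_distribution A = (\<integral>x. indicator A x \<partial>std_normal_distribution)"
    by simp
  also have "\<dots> = (LBINT x:A. std_normal_density x)"
    by (subst integral_density) (auto simp: set_lebesgue_integral_def mult.commute)
  finally show ?thesis .
qed

lemma continuous_on_std_normal_density [continuous_intros]:
  "continuous_on S std_normal_density"
  unfolding std_normal_density_def by (intro continuous_intros) auto

text \<open>A finite lower limit \<open>l\<close> replaces minus infinity, so that the fundamental
  theorem of calculus on compact intervals can be applied to the distribution function.\<close>

lemma std_normal_cdf_eq_integral:
  assumes "l \<le> y"
  shows "std_normal_cdf y = std_normal_cdf l + integral {l..y} std_normal_density"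
proof (cases "l = y")
  case False
  with assms have "l < y" by simp
  interpret real_distribution std_normal_distribution by (rule real_dist_normal_dist)
  have "set_integrable lborel {l..y} std_normal_density"
    by (intro borel_integrable_atLeastAtMost' continuous_intros)
  then have int: "set_integrable lborel {l<..y} std_normal_density"
    by (rule set_integrable_subset) auto
  have "std_normal_cdf y - std_normal_cdf l = measure std_normal_distribution {l<..y}"
    by (rule cdf_diff_eq) fact
  also have "\<dots> = integral {l<..y} std_normal_density"
    using int by (simp add: measure_std_normal_eq_integral set_borel_integral_eq_integral(2))
  also have "\<dots> = integral {l..y} std_normal_density"
    by (rule integral_spike_set; rule negligible_subset[of "{l}"]) auto
  finally show ?thesis by simp
qed simp

lemma DERIV_std_normal_cdf:
  "(std_normal_cdf has_real_derivative std_normal_density x) (at x)"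
proof -
  \<comment> \<open>The base point \<open>x-1\<close> lies strictly left of \<open>x\<close>, so
    \<open>x\<close> is interior to the interval and the derivative within it is the full
    derivative.\<close>
  have "((\<lambda>y. integral {x-1..y} std_normal_density) has_real_derivative std_normal_density x)
      (at x within {x-1..x+1})"
    by (intro integral_has_real_derivative continuous_intros) auto
  then have "((\<lambda>y. std_normal_cdf (x-1) + integral {x-1..y} std_normal_density)
      has_real_derivative std_normal_density x) (at x within {x-1..x+1})"
    by (auto intro!: derivative_eq_intros)
  then have "(std_normal_cdf has_real_derivative std_normal_density x) (at x within {x-1..x+1})"
    by (rule has_field_derivative_transform_within[where d = 1])
       (auto intro!: std_normal_cdf_eq_integral[symmetric])
  moreover have "at x within {x-1..x+1} = at x"
    by (rule at_within_interior) (auto simp: interior_atLeastAtMost_real)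
  ultimately show ?thesis by simp
qed

lemma std_normal_cdf_at_top: "(std_normal_cdf \<longlongrightarrow> 1) at_top"
proof -
  interpret real_distribution std_normal_distribution by (rule real_dist_normal_dist)
  show ?thesis by (rule cdf_lim_at_top_prob)
qed

lemma std_normal_cdf_at_bot: "(std_normal_cdf \<longlongrightarrow> 0) at_bot"
proof -
  interpret real_distribution std_normal_distribution by (rule real_dist_normal_dist)
  show ?thesis by (rule cdf_lim_at_bot)
qed

text \<open>The density is even, so \<open>?g\<close> has derivative 0 and is constant; its limit at
  infinity identifies the constant as 1. At \<open>x = 0\<close> this yields the value 1/2.\<close>

lemma std_normal_cdf_minus: "std_normal_cdf (- x) = 1 - std_normal_cdf x"
proof -
  let ?g = "\<lambda>x. std_normal_cdf x + std_normal_cdf (- x)"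
  have even: "std_normal_density (- y) = std_normal_density y" for y
    by (simp add: std_normal_density_def)
  have "((\<lambda>x. std_normal_cdf (- x)) has_real_derivative std_normal_density (- y) * - 1) (at y)" for y
    by (intro DERIV_chain2[OF DERIV_std_normal_cdf]) (auto intro!: derivative_eq_intros)
  from DERIV_add[OF DERIV_std_normal_cdf this]
  have "(?g has_real_derivative 0) (at y)" for y
    by (simp add: even)
  then have "?g y = ?g x" for y
    by (intro DERIV_isconst_all allI)
  then have "?g = (\<lambda>_. ?g x)"
    by (rule ext)
  then have "(?g \<longlongrightarrow> ?g x) at_top"
    by (metis tendsto_const)
  moreover have "(?g \<longlongrightarrow> 1 + 0) at_top"
    by (intro tendsto_add std_normal_cdf_at_top
        filterlim_compose[OF std_normal_cdf_at_bot filterlim_uminus_at_bot_at_top])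
  ultimately have "?g x = 1 + 0"
    by (intro tendsto_unique[where F = at_top and f = ?g]) auto
  then show ?thesis by simp
qed

text \<open>Since \<open>f\<close> is nonnegative, its integrability follows from the existence of
  the two limits of \<open>F\<close>, without a separate domination argument.\<close>

lemma LBINT_FTC_nonneg_greaterThan:
  fixes f F :: "real \<Rightarrow> real"
  assumes F: "\<And>x. x > a \<Longrightarrow> (F has_real_derivative f x) (at x)"
    and f: "\<And>x. x > a \<Longrightarrow> isCont f x" "\<And>x. x > a \<Longrightarrow> 0 \<le> f x"
    and A: "(F \<longlongrightarrow> A) (at_right a)" and B: "(F \<longlongrightarrow> B) at_top"
  shows "(LBINT x:{a<..}. f x) = B - A"
proof -
  have "(LBINT x=ereal a..\<infinity>. f x) = B - A"
    by (rule interval_integral_FTC_nonneg(2)[where F = F])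
       (use assms in \<open>auto simp: ereal_tendsto_simps\<close>)
  then show ?thesis
    by (simp add: interval_lebesgue_integral_def)
qed

section \<open>The functions \<open>F_c\<close>: derivative and boundary limits\<close>

context
  fixes a c :: real
begin

text \<open>The sign of \<open>c\<close> is left open because the formula is used at both
  \<open>c\<close> and \<open>- c\<close>; only the summand \<open>c / (2 * sqrt t)\<close>
  distinguishes the two.\<close>

lemma DERIV_std_normal_cdf_sqrt:
  assumes "t > 0"
  shows "((\<lambda>t. exp (- a * c) * std_normal_cdf (c * sqrt t - a / sqrt t)) has_real_derivative
      exp (- a\<^sup>2 / (2 * t)) * exp (- (c\<^sup>2 / 2) * t) / sqrt (2 * pi) * (c / (2 * sqrt t) + a / (2 * t * sqrt t)))
    (at t)"
proof -
  define u where "u = c * sqrt t - a / sqrt t"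
  have "u\<^sup>2 = c\<^sup>2 * t - 2 * (a * c) + a\<^sup>2 / t"
    using assms by (simp add: u_def power2_diff power_mult_distrib power_divide)
  then have "- a * c + - u\<^sup>2 / 2 = - a\<^sup>2 / (2 * t) + - (c\<^sup>2 / 2) * t"
    using assms by (simp add: field_simps)
  then have density: "exp (- a * c) * std_normal_density u
      = exp (- a\<^sup>2 / (2 * t)) * exp (- (c\<^sup>2 / 2) * t) / sqrt (2 * pi)"
    by (simp add: std_normal_density_def flip: exp_add)
  have "((\<lambda>t. c * sqrt t - a / sqrt t) has_real_derivative
      c / (2 * sqrt t) + a / (2 * t * sqrt t)) (at t)"
    using assms by (auto intro!: derivative_eq_intros simp: field_simps)
  then have "((\<lambda>t. exp (- a * c) * std_normal_cdf (c * sqrt t - a / sqrt t)) has_real_derivative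
      exp (- a * c) * (std_normal_density u * (c / (2 * sqrt t) + a / (2 * t * sqrt t)))) (at t)"
    unfolding u_def by (intro DERIV_cmult DERIV_chain2[OF DERIV_std_normal_cdf])
  then show ?thesis
    using density by (simp only: mult.assoc[symmetric])
qed

text \<open>Near 0 the term \<open>- a / sqrt t\<close> dominates and drives the argument to minus
  infinity, whatever the sign of \<open>c\<close>.\<close>

lemma std_normal_cdf_sqrt_at_0:
  assumes "a > 0"
  shows "((\<lambda>t. exp (- a * c) * std_normal_cdf (c * sqrt t - a / sqrt t)) \<longlongrightarrow> 0) (at_right 0)"
proof -
  have "filterlim (\<lambda>t. c * sqrt t - a / sqrt t) at_bot (at_right 0)"
    using assms by real_asymp
  from filterlim_compose[OF std_normal_cdf_at_bot this] show ?thesis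
    by (rule tendsto_mult_right_zero)
qed

text \<open>For large \<open>t\<close> the term \<open>c * sqrt t\<close> dominates, so the sign of
  \<open>c\<close> decides between the limits 1 and 0 of the distribution function.\<close>

lemma std_normal_cdf_sqrt_at_top:
  assumes "c > 0"
  shows "((\<lambda>t. exp (- a * c) * std_normal_cdf (c * sqrt t - a / sqrt t)) \<longlongrightarrow> exp (- a * c)) at_top"
proof -
  have "filterlim (\<lambda>t. c * sqrt t - a / sqrt t) at_top at_top"
    using assms by real_asymp
  from tendsto_mult_left[OF filterlim_compose[OF std_normal_cdf_at_top this]] show ?thesis
    by simp
qed

lemma std_normal_cdf_sqrt_at_top_neg:
  assumes "c < 0"
  shows "((\<lambda>t. exp (- a * c) * std_normal_cdf (c * sqrt t - a / sqrt t)) \<longlongrightarrow> 0) at_top"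
proof -
  have "filterlim (\<lambda>t. c * sqrt t - a / sqrt t) at_bot at_top"
    using assms by real_asymp
  from filterlim_compose[OF std_normal_cdf_at_bot this] show ?thesis
    by (rule tendsto_mult_right_zero)
qed

end

text \<open>For \<open>c > 0\<close> only the first summand survives. For \<open>c = 0\<close> the
  two summands coincide and their argument tends to 0, so each contributes 1/2 by continuity and
  reflection; the total is again \<open>exp (- a * c)\<close>.\<close>

lemma std_normal_cdf_sqrt_add_at_top:
  fixes a c :: real
  assumes "c \<ge> 0"
  shows "((\<lambda>t. exp (- a * c) * std_normal_cdf (c * sqrt t - a / sqrt t)
      + exp (- a * - c) * std_normal_cdf (- c * sqrt t - a / sqrt t)) \<longlongrightarrow> exp (- a * c)) at_top"
proof (cases "c = 0")
  case True
  have "((\<lambda>t. - a / sqrt t) \<longlongrightarrow> 0) at_top"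
    by real_asymp
  from isCont_tendsto_compose[OF DERIV_isCont[OF DERIV_std_normal_cdf] this]
  have "((\<lambda>t. 2 * std_normal_cdf (- a / sqrt t)) \<longlongrightarrow> 2 * std_normal_cdf 0) at_top"
    by (rule tendsto_mult_left)
  moreover have "2 * std_normal_cdf 0 = 1"
    using std_normal_cdf_minus[of 0] by simp
  ultimately have "((\<lambda>t. 2 * std_normal_cdf (- a / sqrt t)) \<longlongrightarrow> 1) at_top"
    by (simp only:)
  with True show ?thesis by simp
next
  case False
  with assms show ?thesis
    using tendsto_add[OF std_normal_cdf_sqrt_at_top[of c a] std_normal_cdf_sqrt_at_top_neg[of "- c" a]]
    by simp
qed

section \<open>The two integrals, evaluated from the primitives\<close>

lemma LBINT_hitting_time_density:
  fixes a c :: real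
  assumes "a > 0" "c \<ge> 0"
  shows "(LBINT t:{0<..}. a / (sqrt (2 * pi) * t powr (3/2)) * exp (- a\<^sup>2 / (2 * t)) * exp (- (c\<^sup>2 / 2) * t))
    = exp (- a * c)"
    (is "(LBINT t:_. ?f t) = _")
proof -
  let ?F = "\<lambda>c t. exp (- a * c) * std_normal_cdf (c * sqrt t - a / sqrt t)"
  have "(LBINT t:{0<..}. ?f t) = exp (- a * c) - (0 + 0)"
  proof (rule LBINT_FTC_nonneg_greaterThan[where F = "\<lambda>t. ?F c t + ?F (- c) t"])
    fix t :: real assume t: "t > 0"
    have "t powr (3/2) = t powr (1 + 1/2)" by simp
    also have "\<dots> = t * sqrt t"
      using t by (subst powr_add) (simp add: powr_half_sqrt)
    finally have powr: "t powr (3/2) = t * sqrt t" .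
    \<comment> \<open>In the sum the terms with \<open>c / (2 * sqrt t)\<close> cancel and those
      with \<open>a\<close> double, leaving \<open>a / (t * sqrt t)\<close>.\<close>
    have "?f t = exp (- a\<^sup>2 / (2 * t)) * exp (- (c\<^sup>2 / 2) * t) / sqrt (2 * pi) * (c / (2 * sqrt t) + a / (2 * t * sqrt t))
      + exp (- a\<^sup>2 / (2 * t)) * exp (- ((- c)\<^sup>2 / 2) * t) / sqrt (2 * pi) * (- c / (2 * sqrt t) + a / (2 * t * sqrt t))"
      using t by (simp add: powr field_simps)
    with DERIV_add[OF DERIV_std_normal_cdf_sqrt[OF t, of a c] DERIV_std_normal_cdf_sqrt[OF t, of a "- c"]]
    show "((\<lambda>t. ?F c t + ?F (- c) t) has_real_derivative ?f t) (at t)"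
      by (simp only:)
    show "isCont ?f t" "0 \<le> ?f t"
      using t assms by (auto intro!: continuous_intros)
  next
    show "((\<lambda>t. ?F c t + ?F (- c) t) \<longlongrightarrow> 0 + 0) (at_right 0)"
      by (intro tendsto_add std_normal_cdf_sqrt_at_0 assms)
    show "((\<lambda>t. ?F c t + ?F (- c) t) \<longlongrightarrow> exp (- a * c)) at_top"
      by (intro std_normal_cdf_sqrt_add_at_top assms)
  qed
  then show ?thesis by simp
qed

lemma LBINT_gamma_half_half_exp_inverse:
  fixes a :: real
  assumes "a > 0"
  shows "(LBINT x:{0<..}. gamma_density (1/2) (1/2) x * exp (- a\<^sup>2 / (2 * x))) = exp (- a)"
proof -
  let ?F = "\<lambda>c t. exp (- a * c) * std_normal_cdf (c * sqrt t - a / sqrt t)"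
  let ?f = "\<lambda>t. exp (- a\<^sup>2 / (2 * t)) * exp (- t / 2) / (sqrt (2 * pi) * sqrt t)"
  have eq: "gamma_density (1/2) (1/2) t * exp (- a\<^sup>2 / (2 * t)) = ?f t" if "t > 0" for t
    using that
    by (simp add: gamma_density_half_half powr_minus powr_half_sqrt divide_simps)
  have "(LBINT x:{0<..}. ?f x) = (exp (- a * 1) - 0) - (0 - 0)"
  proof (rule LBINT_FTC_nonneg_greaterThan[where F = "\<lambda>t. ?F 1 t - ?F (- 1) t"])
    fix t :: real assume t: "t > 0"
    \<comment> \<open>In the difference the terms with \<open>a\<close> cancel instead, leaving
      \<open>1 / sqrt t\<close>; the choice \<open>c = 1\<close> turns \<open>c\<^sup>2 / 2\<close>
      into the rate 1/2.\<close>
    have "?f t = exp (- a\<^sup>2 / (2 * t)) * exp (- (1\<^sup>2 / 2) * t) / sqrt (2 * pi) * (1 / (2 * sqrt t) + a / (2 * t * sqrt t))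
      - exp (- a\<^sup>2 / (2 * t)) * exp (- ((- 1)\<^sup>2 / 2) * t) / sqrt (2 * pi) * (- 1 / (2 * sqrt t) + a / (2 * t * sqrt t))"
      using t by (simp add: field_simps)
    with DERIV_diff[OF DERIV_std_normal_cdf_sqrt[OF t, of a 1] DERIV_std_normal_cdf_sqrt[OF t, of a "- 1"]]
    show "((\<lambda>t. ?F 1 t - ?F (- 1) t) has_real_derivative ?f t) (at t)"
      by (simp only:)
    show "isCont ?f t" "0 \<le> ?f t"
      using t by (auto intro!: continuous_intros)
  next
    show "((\<lambda>t. ?F 1 t - ?F (- 1) t) \<longlongrightarrow> 0 - 0) (at_right 0)"
      by (intro tendsto_diff std_normal_cdf_sqrt_at_0 assms)
    show "((\<lambda>t. ?F 1 t - ?F (- 1) t) \<longlongrightarrow> exp (- a * 1) - 0) at_top"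
      by (intro tendsto_diff std_normal_cdf_sqrt_at_top std_normal_cdf_sqrt_at_top_neg) auto
  qed
  moreover have "(LBINT x:{0<..}. gamma_density (1/2) (1/2) x * exp (- a\<^sup>2 / (2 * x)))
      = (LBINT x:{0<..}. ?f x)"
    by (rule set_lebesgue_integral_cong) (use eq in auto)
  ultimately show ?thesis by simp
qed

lemma (in prob_space) expectation_exp_inverse_gamma_half_half:
  assumes G: "distributed M lborel G (\<lambda>x. ennreal (gamma_density (1/2) (1/2) x))"
    and "\<theta> \<ge> 0"
  shows "expectation (\<lambda>\<omega>. exp (- \<theta>\<^sup>2 / (2 * G \<omega>))) = exp (- \<theta>)"
\<comment> \<open>The integral formula requires \<open>a > 0\<close>; for
  \<open>\<theta> = 0\<close> the random variable is the constant 1.\<close>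
proof (cases "\<theta> = 0")
  case False
  have "expectation (\<lambda>\<omega>. exp (- \<theta>\<^sup>2 / (2 * G \<omega>)))
      = (LBINT x. gamma_density (1/2) (1/2) x * exp (- \<theta>\<^sup>2 / (2 * x)))"
    by (rule distributed_integral[OF G, symmetric]) (auto simp: gamma_density_half_half)
  \<comment> \<open>The density is 0 for \<open>x \<le> 0\<close>, so both integrands vanish there,
    also at \<open>x = 0\<close> where the quotient takes its default value 0.\<close>
  also have "\<dots> = (LBINT x:{0<..}. gamma_density (1/2) (1/2) x * exp (- \<theta>\<^sup>2 / (2 * x)))"
    unfolding set_lebesgue_integral_def
    by (rule Bochner_Integration.integral_cong) (auto simp: gamma_density_def indicator_def)
  finally show ?thesis
    using LBINT_gamma_half_half_exp_inverse[of \<theta>] False assms(2) by simp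
qed (simp add: prob_space)

theorem proposition1:
  fixes M :: "'a measure" and G :: "'a \<Rightarrow> real"
  shows "(\<forall>(a::real) (lam::real). a > 0 \<longrightarrow> lam \<ge> 0 \<longrightarrow>
            (LBINT t:{0<..}. a / (sqrt (2 * pi) * t powr (3/2)) * exp (- a\<^sup>2 / (2 * t)) * exp (- lam * t))
              = exp (- a * sqrt (2 * lam))) \<and>
         (\<forall>\<theta>::real. \<theta> \<ge> 0 \<longrightarrow> prob_space M \<longrightarrow>
            distributed M lborel G (\<lambda>x. ennreal (gamma_density (1/2) (1/2) x)) \<longrightarrow>
            prob_space.expectation M (\<lambda>\<omega>. exp (- \<theta>\<^sup>2 / (2 * G \<omega>))) = exp (- \<theta>))"
proof (intro conjI allI impI)
  fix a lam :: real assume "a > 0" "lam \<ge> 0"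
  then show "(LBINT t:{0<..}. a / (sqrt (2 * pi) * t powr (3/2)) * exp (- a\<^sup>2 / (2 * t)) * exp (- lam * t))
      = exp (- a * sqrt (2 * lam))"
    \<comment> \<open>With \<open>c = sqrt (2 * lam)\<close> the rate \<open>c\<^sup>2 / 2\<close>
      equals \<open>lam\<close>, because \<open>lam \<ge> 0\<close>.\<close>
    using LBINT_hitting_time_density[of a "sqrt (2 * lam)"] by simp
next
  fix \<theta> :: real
  assume "\<theta> \<ge> 0" "prob_space M"
    "distributed M lborel G (\<lambda>x. ennreal (gamma_density (1/2) (1/2) x))"
  then show "prob_space.expectation M (\<lambda>\<omega>. exp (- \<theta>\<^sup>2 / (2 * G \<omega>))) = exp (- \<theta>)"
    by (intro prob_space.expectation_exp_inverse_gamma_half_half)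
qed

end
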